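(* For every positive integer $k$ there exists a tree $T$ such that $\gamma_g(T)=k$ and $\gamma_g'(T)=k+1$.
   Context: Graphs are finite, simple and nonempty. For a vertex $v$, $N[v]$ is its closed neighborhood; a chosen vertex $v$ dominates all vertices of $N[v]$. The domination game on a graph $G$ is played by two players, Dominator and Staller, who alternately choose vertices of $G$; each chosen vertex must dominate at least one vertex that was not dominated by the previously chosen vertices. The game ends when all vertices of $G$ are dominated. Dominator wants the total number of chosen vertices to be as small as possible, Staller wants it to be as large as possible. The game domination number $\gamma_g(G)$ is the total number of vertices chosen (by both players) when Dominator makes the first move and both players play optimally; the Staller-start game domination number $\gamma_g'(G)$ is the total number of vertices chosen when Staller makes the first move and both players play optimally. *)

theory Defs
  imports "Graph_Theory.Digraph_Component"
begin

text \<open>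
  A finite simple graph is a \<^locale>\<open>pair_graph\<close>, i.e. a finite symmetric loop-free digraph
  without parallel arcs; an undirected edge is a pair of opposite arcs. The predicate
  \<^const>\<open>tree\<close> of \<^theory>\<open>Graph_Theory.Digraph_Component\<close> is not suitable for undirected graphs:
  \<^const>\<open>pre_digraph.cycle\<close> also counts the closed walk \<open>a, b, a\<close> along an edge as a cycle.
  The cycles of the undirected graph are exactly those with at least three arcs.
  Nonemptiness of the vertex set is part of \<^const>\<open>connected\<close>.
\<close>

definition undirected_tree :: "'a pair_pre_digraph \<Rightarrow> bool" where
  "undirected_tree G \<longleftrightarrow>
     pair_graph G \<and> connected (with_proj G) \<and>
     \<not> (\<exists>p. pre_digraph.cycle (with_proj G) p \<and> 3 \<le> length p)"

definition closed_nbhd :: "'a pair_pre_digraph \<Rightarrow> 'a \<Rightarrow> 'a set" where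
  "closed_nbhd G v = insert v {u. (v, u) \<in> parcs G}"

definition dominated :: "'a pair_pre_digraph \<Rightarrow> 'a set \<Rightarrow> 'a set" where
  "dominated G S = (\<Union>v\<in>S. closed_nbhd G v)"

definition legal_moves :: "'a pair_pre_digraph \<Rightarrow> 'a set \<Rightarrow> 'a set" where
  "legal_moves G S = {v \<in> pverts G. \<exists>u \<in> closed_nbhd G v. u \<notin> dominated G S}"

datatype player = Dominator | Staller

fun opponent :: "player \<Rightarrow> player" where
  "opponent Dominator = Staller"
| "opponent Staller = Dominator"

lemma card_diff_insert_legal_move:
  assumes "finite (pverts G)" "v \<in> legal_moves G S"
  shows "card (pverts G - insert v S) < card (pverts G - S)"
proof (rule psubset_card_mono)
  show "finite (pverts G - S)"
    using assms(1) by simp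
  show "pverts G - insert v S \<subset> pverts G - S"
    using assms(2) by (auto simp: legal_moves_def dominated_def)
qed

text \<open>
  Minimax value of a position: \<open>S\<close> is the set of vertices chosen so far, \<open>p\<close> is the player to
  move, and the value is the number of vertices still to be chosen (by both players) under optimal
  play. The minimum and maximum range over a nonempty set, because an undominated vertex is itself a
  legal move. The test for finiteness only serves to make the recursion terminate; it holds in every
  \<^locale>\<open>pair_graph\<close>.
\<close>

function game_value :: "'a pair_pre_digraph \<Rightarrow> player \<Rightarrow> 'a set \<Rightarrow> nat" where
  "game_value G p S =
     (if infinite (pverts G) \<or> pverts G \<subseteq> dominated G S then 0
      else 1 + (case p of
          Dominator \<Rightarrow> Min ((\<lambda>v. game_value G (opponent p) (insert v S)) ` legal_moves G S)
        | Staller \<Rightarrow> Max ((\<lambda>v. game_value G (opponent p) (insert v S)) ` legal_moves G S)))"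
  by pat_completeness auto
termination
  by (relation "measure (\<lambda>(G, p, S). card (pverts G - S))")
    (auto intro!: card_diff_insert_legal_move)

declare game_value.simps [simp del]

definition game_dom_number :: "'a pair_pre_digraph \<Rightarrow> nat" ("\<gamma>\<^sub>g") where
  "\<gamma>\<^sub>g G = game_value G Dominator {}"

definition staller_start_game_dom_number :: "'a pair_pre_digraph \<Rightarrow> nat" ("\<gamma>\<^sub>g''") where
  "\<gamma>\<^sub>g' G = game_value G Staller {}"

lemma legal_moves_nonempty:
  assumes "\<not> pverts G \<subseteq> dominated G S"
  shows "legal_moves G S \<noteq> {}"
  using assms by (auto simp: legal_moves_def closed_nbhd_def)

end

theory Submission
  imports Defs
begin

text \<open>
  For \<open>k = m + 1\<close> take a centre with two leaves and with \<open>m\<close> pendant paths of length two. Any set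
  of undominated vertices with pairwise disjoint closed neighbourhoods bounds the remaining length
  of the game from below, and the number of undominated vertices bounds it from above. The ends of
  the paths together with one leaf show that every game takes at least \<open>m + 1\<close> moves; once Dominator has
  played the centre, only the \<open>m\<close> ends of the paths are undominated. A Staller who starts on a
  leaf wastes a move, since the other leaf and the \<open>m\<close> ends still need \<open>m + 1\<close> moves; no first move
  of Staller does better, as Dominator answers in the centre.
\<close>

section \<open>Bounds for the domination game\<close>

lemma finite_legal_moves: "finite (pverts G) \<Longrightarrow> finite (legal_moves G S)"
  by (simp add: legal_moves_def)

lemma dominated_insert: "dominated G (insert v S) = closed_nbhd G v \<union> dominated G S"
  by (simp add: dominated_def)

lemma game_value_eq_0: "pverts G \<subseteq> dominated G S \<Longrightarrow> game_value G p S = 0"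
  by (simp add: game_value.simps)

text \<open>\<open>Min\<close> and \<open>Max\<close> of a finite nonempty set are both attained.
  Bounds that hold for every play can thus be proved by following one move, without distinguishing
  the players.\<close>

lemma game_value_Suc:
  assumes "finite (pverts G)" "\<not> pverts G \<subseteq> dominated G S"
  obtains v where "v \<in> legal_moves G S"
    "game_value G p S = Suc (game_value G (opponent p) (insert v S))"
proof -
  let ?A = "(\<lambda>v. game_value G (opponent p) (insert v S)) ` legal_moves G S"
  have "finite ?A" "?A \<noteq> {}"
    using assms by (auto simp: finite_legal_moves legal_moves_nonempty)
  then have "Min ?A \<in> ?A" "Max ?A \<in> ?A"
    by (blast intro: Min_in Max_in)+
  moreover have "game_value G p S = Suc (case p of Dominator \<Rightarrow> Min ?A | Staller \<Rightarrow> Max ?A)"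
    using assms by (subst game_value.simps) simp
  ultimately have "game_value G p S \<in> Suc ` ?A"
    by (cases p) simp_all
  then show thesis
    using that by auto
qed

lemma game_value_Dominator_le:
  assumes "finite (pverts G)" "v \<in> legal_moves G S"
  shows "game_value G Dominator S \<le> Suc (game_value G Staller (insert v S))"
\<comment> \<open>For arbitrary \<open>G\<close> a neighbour may lie outside
  \<open>pverts G\<close>, so a legal move does not rule out a finished game, whose value is
  0.\<close>
proof (cases "pverts G \<subseteq> dominated G S")
  case True
  then show ?thesis
    by (simp add: game_value_eq_0)
next
  case False
  have "Min ((\<lambda>v. game_value G Staller (insert v S)) ` legal_moves G S)
      \<le> game_value G Staller (insert v S)"
    using assms by (intro Min_le) (auto simp: finite_legal_moves)
  then show ?thesis
    using False assms(1) by (subst game_value.simps) simp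
qed

lemma game_value_Staller_ge:
  assumes "finite (pverts G)" "\<not> pverts G \<subseteq> dominated G S" "v \<in> legal_moves G S"
  shows "Suc (game_value G Dominator (insert v S)) \<le> game_value G Staller S"
proof -
  have "game_value G Dominator (insert v S)
      \<le> Max ((\<lambda>v. game_value G Dominator (insert v S)) ` legal_moves G S)"
    using assms by (intro Max_ge) (auto simp: finite_legal_moves)
  moreover have "game_value G Staller S
      = Suc (Max ((\<lambda>v. game_value G Dominator (insert v S)) ` legal_moves G S))"
    using assms(1,2) by (subst game_value.simps) simp
  ultimately show ?thesis
    by simp
qed

text \<open>Each move dominates at most one vertex of \<open>U\<close>, and the others still form an
  undominated packing.\<close>

lemma card_packing_le_game_value:
  assumes "finite (pverts G)" "U \<subseteq> pverts G - dominated G S"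
    and packing: "\<And>v. v \<in> pverts G \<Longrightarrow> card (U \<inter> closed_nbhd G v) \<le> 1"
  shows "card U \<le> game_value G p S"
proof -
  \<comment> \<open>The induction is on a lower bound \<open>n\<close> of \<open>card U\<close>,
    since a move may also miss \<open>U\<close> altogether.\<close>
  have "n \<le> game_value G p S"
    if "n \<le> card U" "U \<subseteq> pverts G - dominated G S"
      "\<And>v. v \<in> pverts G \<Longrightarrow> card (U \<inter> closed_nbhd G v) \<le> 1" for n U
    using that
  proof (induction n arbitrary: p S U)
    case 0
    then show ?case
      by simp
  next
    case (Suc n)
    have fin: "finite U"
      using Suc.prems(2) assms(1) finite_subset by blast
    have "U \<noteq> {}"
      using Suc.prems(1) by auto
    then have "\<not> pverts G \<subseteq> dominated G S"
      using Suc.prems(2) by blast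
    then obtain v where v: "v \<in> legal_moves G S"
      "game_value G p S = Suc (game_value G (opponent p) (insert v S))"
      using game_value_Suc[OF assms(1)] by blast
    have "v \<in> pverts G"
      using v(1) by (simp add: legal_moves_def)
    have "n \<le> game_value G (opponent p) (insert v S)"
    proof (rule Suc.IH)
      have "card U = card (U \<inter> closed_nbhd G v) + card (U - closed_nbhd G v)"
        using fin by (simp add: card_Int_Diff)
      then show "n \<le> card (U - closed_nbhd G v)"
        using Suc.prems(1) Suc.prems(3)[OF \<open>v \<in> pverts G\<close>] by linarith
      show "U - closed_nbhd G v \<subseteq> pverts G - dominated G (insert v S)"
        using Suc.prems(2) by (auto simp: dominated_insert)
      show "card ((U - closed_nbhd G v) \<inter> closed_nbhd G w) \<le> 1" if "w \<in> pverts G" for w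
        using Suc.prems(3)[OF that] card_mono[of "U \<inter> closed_nbhd G w"
            "(U - closed_nbhd G v) \<inter> closed_nbhd G w"] fin by fastforce
    qed
    then show ?case
      by (simp add: v(2))
  qed
  then show ?thesis
    using assms(2) packing by blast
qed

text \<open>Every legal move dominates a new vertex, and this vertex is counted because arcs end in
  \<open>pverts G\<close>.\<close>

lemma game_value_le_card_undominated:
  assumes "pair_fin_digraph G"
  shows "game_value G p S \<le> card (pverts G - dominated G S)"
proof -
  interpret pair_fin_digraph G
    by fact
  show ?thesis
  proof (induction "card (pverts G - dominated G S)" arbitrary: p S rule: less_induct)
    case less
    show ?case
    proof (cases "pverts G \<subseteq> dominated G S")
      case True
      then show ?thesis
        by (simp add: game_value_eq_0)
    next
      case False
      then obtain v where v: "v \<in> legal_moves G S"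
        "game_value G p S = Suc (game_value G (opponent p) (insert v S))"
        using game_value_Suc[OF pair_finite_verts] by blast
      from v(1) obtain u where u: "v \<in> pverts G" "u \<in> closed_nbhd G v" "u \<notin> dominated G S"
        by (auto simp: legal_moves_def)
      then have "u \<in> pverts G"
        by (force simp: closed_nbhd_def dest: arc_snd_in_verts)
      then have "pverts G - dominated G (insert v S) \<subset> pverts G - dominated G S"
        using u by (auto simp: dominated_insert)
      then have "card (pverts G - dominated G (insert v S)) < card (pverts G - dominated G S)"
        by (simp add: psubset_card_mono pair_finite_verts)
      then show ?thesis
        using less.hyps[of "insert v S" "opponent p"] v(2) by simp
    qed
  qed
qed

section \<open>Trees given by a parent function\<close>

text \<open>The root is 0. That this is a tree rests on parents being smaller than their children,
  which the context below assumes.\<close>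

definition parent_graph :: "(nat \<Rightarrow> nat) \<Rightarrow> nat \<Rightarrow> nat pair_pre_digraph" where
  "parent_graph f n = \<lparr>pverts = {..n},
     parcs = (\<Union>v\<in>{1..n}. {(v, f v), (f v, v)})\<rparr>"

lemma pverts_parent_graph: "pverts (parent_graph f n) = {..n}"
  by (simp add: parent_graph_def)

context
  fixes f :: "nat \<Rightarrow> nat"
  assumes f_less: "\<And>v. 0 < v \<Longrightarrow> f v < v"
begin

lemma parent_le: "0 < v \<Longrightarrow> v \<le> n \<Longrightarrow> f v \<le> n"
  using f_less[of v] by simp

lemma parent_neq: "0 < v \<Longrightarrow> f v \<noteq> v"
  using f_less[of v] by simp

lemma parent_graph_pair_graph: "pair_graph (parent_graph f n)"
proof unfold_locales
  show "symmetric (parent_graph f n)"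
    by (auto simp: parent_graph_def symmetric_def sym_def arcs_ends_def arc_to_ends_def)
qed (auto simp: parent_graph_def parent_le parent_neq parent_neq[symmetric])

text \<open>One end of an arc is the parent of the other, and the parent is the smaller one. So a
  vertex has only one smaller neighbour.\<close>

lemma parent_graph_arc_greater:
  assumes "(u, v) \<in> parcs (parent_graph f n)"
  shows "v < u \<Longrightarrow> v = f u" "u < v \<Longrightarrow> u = f v"
  using assms f_less[of u] f_less[of v] by (auto simp: parent_graph_def)

text \<open>Following parents leads from every vertex down to 0, and symmetry reverses these
  paths.\<close>

lemma parent_graph_connected: "connected (with_proj (parent_graph f n))"
proof -
  interpret pair_graph "parent_graph f n"
    by (rule parent_graph_pair_graph)
  have to_root: "v \<rightarrow>\<^sup>*\<^bsub>with_proj (parent_graph f n)\<^esub> 0" if "v \<le> n" for v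
    using that
  proof (induction v rule: less_induct)
    case (less v)
    show ?case
    proof (cases "v = 0")
      case True
      have "0 \<in> pverts (parent_graph f n)"
        by (simp add: pverts_parent_graph)
      with True show ?thesis
        using reachable_refl by blast
    next
      case False
      then have "(v, f v) \<in> parcs (parent_graph f n)" "f v < v"
        using less.prems f_less by (auto simp: parent_graph_def)
      then show ?thesis
        using less.IH[of "f v"] less.prems adj_reachable_trans[of v "f v" 0] by simp
    qed
  qed
  have sym: "symmetric (with_proj (parent_graph f n))"
    using sym_arcs .
  have "strongly_connected (with_proj (parent_graph f n))"
  proof (rule strongly_connectedI)
    show "verts (with_proj (parent_graph f n)) \<noteq> {}"
      by (auto simp: parent_graph_def)
    show "u \<rightarrow>\<^sup>*\<^bsub>with_proj (parent_graph f n)\<^esub> v"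
      if "u \<in> verts (with_proj (parent_graph f n))" "v \<in> verts (with_proj (parent_graph f n))"
      for u v
    proof -
      have "u \<rightarrow>\<^sup>*\<^bsub>with_proj (parent_graph f n)\<^esub> 0" "v \<rightarrow>\<^sup>*\<^bsub>with_proj (parent_graph f n)\<^esub> 0"
        using that by (auto intro!: to_root simp: pverts_parent_graph)
      then show ?thesis
        using symmetric_reachable[OF sym] reachable_trans by blast
    qed
  qed
  \<comment> \<open>\<open>connected\<close> refers to the symmetric closure, in which a symmetric
    graph has the same reachability.\<close>
  then show ?thesis
    using sym reachable_mk_symmetric_eq by (simp add: connected_def strongly_connected_def)
qed

text \<open>Both neighbours of the largest vertex of a cycle would be its parent.\<close>

lemma parent_graph_no_cycle:
  assumes "pre_digraph.cycle (with_proj (parent_graph f n)) p"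
  shows "length p \<le> 2"
proof -
  interpret pair_graph "parent_graph f n"
    by (rule parent_graph_pair_graph)
  obtain u where walk: "awalk u p u" and p: "p \<noteq> []" and dist: "distinct (tl (awalk_verts u p))"
    using assms unfolding cycle_def by auto
  \<comment> \<open>Each arc starts where the previous one ends. On a closed walk the end points are
    therefore the start points rotated by one, which justifies the cyclic indexing below.\<close>
  have arcs: "set p \<subseteq> parcs (parent_graph f n)" and cas: "cas u p u"
    using walk by (auto simp: awalk_def)
  have cas_snd: "map snd q = tl (map fst q @ [w])" if "cas v q w" for v q w
    using that
  proof (induction q arbitrary: v)
    case (Cons e q)
    then show ?case
      by (cases q) auto
  qed simp
  have "u = fst (hd p)"
    using cas p by (cases p) auto
  then have snd_p: "map snd p = rotate1 (map fst p)"
    using cas_snd[OF cas] p by (cases p) auto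
  have "awalk_verts u p = u # map snd p" if "cas u p v" for u p v
    using that by (induction p arbitrary: u) auto
  with dist cas have "distinct (map snd p)"
    by (metis list.sel(3))
  then have dist_fst: "distinct (map fst p)"
    by (simp add: snd_p)
  let ?n = "length p"
  have snd_nth: "snd (p ! i) = fst (p ! (Suc i mod ?n))" if "i < ?n" for i
  proof -
    have "snd (p ! i) = rotate1 (map fst p) ! i"
      using that by (simp flip: snd_p)
    also have "\<dots> = fst (p ! (Suc i mod ?n))"
      using that p by (simp add: nth_rotate1)
    finally show ?thesis .
  qed
  \<comment> \<open>\<open>M\<close> is the largest vertex of the cycle; arc \<open>i\<close> leaves
    it and arc \<open>j\<close> enters it.\<close>
  define M where "M = Max (fst ` set p)"
  have "M \<in> fst ` set p"
    unfolding M_def using p by (intro Max_in) auto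
  moreover have sets: "snd ` set p = fst ` set p"
    by (metis list.set_map set_rotate1 snd_p)
  ultimately obtain i j where i: "i < ?n" "fst (p ! i) = M" and j: "j < ?n" "snd (p ! j) = M"
    by (metis (no_types, lifting) imageE in_set_conv_nth)
  have le_M: "fst e \<le> M" "snd e \<le> M" if "e \<in> set p" for e
    unfolding M_def using that by (simp, metis List.finite_set Max_ge finite_imageI imageI sets)
  \<comment> \<open>The other end of each of these arcs is at most \<open>M\<close> and, without
    loops, smaller; hence it is the parent of \<open>M\<close>.\<close>
  have "snd (p ! i) = f M"
    using i arcs le_M(2)[of "p ! i"] no_loops[of "p ! i"] parent_graph_arc_greater(1)[of M "snd (p ! i)" n]
    by (metis le_neq_implies_less nth_mem prod.collapse subsetD)
  moreover have "fst (p ! j) = f M"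
    using j arcs le_M(1)[of "p ! j"] no_loops[of "p ! j"] parent_graph_arc_greater(2)[of "fst (p ! j)" M n]
    by (metis le_neq_implies_less nth_mem prod.collapse subsetD)
  \<comment> \<open>Start points are distinct, so \<open>i\<close> and \<open>j\<close> are cyclic
    successors of each other: two steps lead back to \<open>i\<close>, and the length divides
    2.\<close>
  ultimately have "fst (p ! j) = fst (p ! (Suc i mod ?n))" "fst (p ! i) = fst (p ! (Suc j mod ?n))"
    using snd_nth i j by metis+
  then have "j = Suc i mod ?n" "i = Suc j mod ?n"
    using nth_eq_iff_index_eq[OF dist_fst] i(1) j(1) p by simp_all
  then have "i mod ?n = Suc (Suc i) mod ?n"
    by (metis mod_Suc_eq mod_mod_trivial)
  then have "?n dvd 2"
    using mod_eq_dvd_iff_nat[of i "Suc (Suc i)" ?n] by auto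
  then show ?thesis
    by (simp add: dvd_imp_le)
qed

lemma parent_graph_undirected_tree: "undirected_tree (parent_graph f n)"
  using parent_graph_pair_graph parent_graph_connected parent_graph_no_cycle
  by (force simp: undirected_tree_def)

end

section \<open>A star with two leaves and \<open>m\<close> longer legs\<close>

text \<open>
  The centre is \<open>0\<close>, its leaves are \<open>1\<close> and \<open>2\<close>, and the legs are \<open>0, 2 i + 3, 2 i + 4\<close> for \<open>i < m\<close>.
\<close>

definition leg_parent :: "nat \<Rightarrow> nat" where
  "leg_parent v = (if even v \<and> 2 < v then v - 1 else 0)"

definition legged_star :: "nat \<Rightarrow> nat pair_pre_digraph" where
  "legged_star m = parent_graph leg_parent (2 * m + 2)"

definition leg_ends :: "nat \<Rightarrow> nat set" where
  "leg_ends m = (\<lambda>i. 2 * i + 4) ` {..<m}"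

lemma card_leg_ends: "card (leg_ends m) = m"
  by (simp add: leg_ends_def card_image inj_on_def)

lemma leg_ends_iff: "v \<in> leg_ends m \<longleftrightarrow> even v \<and> 2 < v \<and> v \<le> 2 * m + 2"
proof
  assume "even v \<and> 2 < v \<and> v \<le> 2 * m + 2"
  then have "v = 2 * (v div 2 - 2) + 4" "v div 2 - 2 < m"
    by (auto elim!: evenE)
  then show "v \<in> leg_ends m"
    unfolding leg_ends_def by blast
qed (auto simp: leg_ends_def)

lemma pverts_legged_star: "pverts (legged_star m) = {..2 * m + 2}"
  by (simp add: legged_star_def pverts_parent_graph)

lemma legged_star_tree: "undirected_tree (legged_star m)"
  unfolding legged_star_def
  by (rule parent_graph_undirected_tree) (auto simp: leg_parent_def)

lemma arc_legged_star_iff: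
  "(u, v) \<in> parcs (legged_star m) \<longleftrightarrow>
    0 < u \<and> u \<le> 2 * m + 2 \<and> v = leg_parent u \<or> 0 < v \<and> v \<le> 2 * m + 2 \<and> u = leg_parent v"
  by (auto simp: legged_star_def parent_graph_def)

lemma closed_nbhd_centre: "closed_nbhd (legged_star m) 0 = pverts (legged_star m) - leg_ends m"
  by (auto simp: closed_nbhd_def pverts_legged_star leg_ends_iff arc_legged_star_iff leg_parent_def)

lemma undominated_centre:
  "pverts (legged_star m) - dominated (legged_star m) (insert 0 S) \<subseteq> leg_ends m"
  unfolding dominated_insert closed_nbhd_centre by blast

text \<open>The leaves 1 and 2 share the neighbour 0, so only one of them may join the ends of the
  legs. Which one is left open: after Staller has opened on 1, leaf 2 is used.\<close>

lemma packing_legged_star: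
  assumes "l \<in> {1, 2}"
  shows "card (insert l (leg_ends m) \<inter> closed_nbhd (legged_star m) v) \<le> 1"
proof -
  \<comment> \<open>The centre meets only the leaf \<open>l\<close>, the middle of a leg only its
    end \<open>v + 1\<close>, and any other vertex at most itself.\<close>
  have "insert l (leg_ends m) \<inter> closed_nbhd (legged_star m) v
      \<subseteq> {if v = 0 then l else if odd v \<and> 2 < v then v + 1 else v}"
    using assms
    by (auto simp: closed_nbhd_def leg_ends_iff arc_legged_star_iff leg_parent_def split: if_splits)
  from card_mono[OF _ this] show ?thesis
    by simp
qed

lemma card_insert_leg_ends: "l \<in> {1, 2} \<Longrightarrow> card (insert l (leg_ends m)) = Suc m"
  using card_leg_ends[of m] by (subst card_insert_disjoint) (auto simp: leg_ends_def)

section \<open>The two game domination numbers of the legged star\<close>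

context
  fixes m :: nat
begin

private abbreviation "T \<equiv> legged_star m"

interpretation pair_graph T
  using legged_star_tree by (simp add: undirected_tree_def)

lemma game_value_after_centre: "game_value T p (insert 0 S) \<le> m"
proof -
  have "game_value T p (insert 0 S) \<le> card (leg_ends m)"
    using game_value_le_card_undominated[OF pair_fin_digraph, of p "insert 0 S"]
      card_mono[OF _ undominated_centre, of m S] by (simp add: leg_ends_def)
  then show ?thesis
    by (simp add: card_leg_ends)
qed

lemma legged_star_Dominator_start: "\<gamma>\<^sub>g T = Suc m"
proof (rule antisym)
  have "0 \<in> legal_moves T {}"
    by (auto simp: legal_moves_def pverts_legged_star closed_nbhd_def dominated_def)
  then have "\<gamma>\<^sub>g T \<le> Suc (game_value T Staller {0})"
    unfolding game_dom_number_def by (rule game_value_Dominator_le[OF pair_finite_verts])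
  then show "\<gamma>\<^sub>g T \<le> Suc m"
    using game_value_after_centre[of Staller "{}"] by simp
  have "card (insert 1 (leg_ends m)) \<le> \<gamma>\<^sub>g T"
    unfolding game_dom_number_def
    by (rule card_packing_le_game_value[OF pair_finite_verts])
      (use packing_legged_star[of 1 m] in \<open>auto simp: dominated_def pverts_legged_star leg_ends_iff\<close>)
  then show "Suc m \<le> \<gamma>\<^sub>g T"
    by (simp add: card_insert_leg_ends)
qed

lemma legged_star_Staller_start: "\<gamma>\<^sub>g' T = Suc (Suc m)"
proof (rule antisym)
  have "\<not> pverts T \<subseteq> dominated T {}"
    by (auto simp: pverts_legged_star dominated_def)
  note start = pair_finite_verts this
  obtain v where v: "v \<in> legal_moves T {}"
    "\<gamma>\<^sub>g' T = Suc (game_value T Dominator {v})"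
    using game_value_Suc[OF start, of Staller] unfolding staller_start_game_dom_number_def
    by auto
  have "game_value T Dominator {v} \<le> Suc m"
  proof (cases "v = 0")
    case True
    then show ?thesis
      using game_value_after_centre[of Dominator "{}"] by simp
  next
    case False
    \<comment> \<open>Only the centre dominates both leaves, so after any other opening it is still
      a legal reply.\<close>
    then have "1 \<notin> closed_nbhd T v \<or> 2 \<notin> closed_nbhd T v"
      by (auto simp: closed_nbhd_def arc_legged_star_iff leg_parent_def split: if_splits)
    moreover have "{1, 2} \<subseteq> closed_nbhd T 0"
      by (auto simp: closed_nbhd_def arc_legged_star_iff leg_parent_def)
    ultimately have "0 \<in> legal_moves T {v}"
      by (auto simp: legal_moves_def dominated_def pverts_legged_star)
    then show ?thesis
      using game_value_Dominator_le[OF pair_finite_verts, of 0 "{v}"]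
        game_value_after_centre[of Staller "{v}"] by simp
  qed
  then show "\<gamma>\<^sub>g' T \<le> Suc (Suc m)"
    by (simp add: v(2))
  have "1 \<in> legal_moves T {}"
    by (auto simp: legal_moves_def pverts_legged_star closed_nbhd_def dominated_def)
  then have "Suc (game_value T Dominator {1}) \<le> \<gamma>\<^sub>g' T"
    unfolding staller_start_game_dom_number_def by (rule game_value_Staller_ge[OF start])
  moreover have "card (insert 2 (leg_ends m)) \<le> game_value T Dominator {1}"
  proof (rule card_packing_le_game_value[OF pair_finite_verts])
    show "insert 2 (leg_ends m) \<subseteq> pverts T - dominated T {1}"
      by (auto simp: dominated_def pverts_legged_star closed_nbhd_def leg_ends_iff
          arc_legged_star_iff leg_parent_def split: if_splits)
  qed (use packing_legged_star[of 2 m] in auto)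
  ultimately show "Suc (Suc m) \<le> \<gamma>\<^sub>g' T"
    by (simp add: card_insert_leg_ends)
qed

end

theorem theorem3p1:
  fixes k :: nat
  assumes "k \<ge> 1"
  shows "\<exists>T :: nat pair_pre_digraph. undirected_tree T \<and> \<gamma>\<^sub>g T = k \<and> \<gamma>\<^sub>g' T = k + 1"
proof -
  obtain m where "k = Suc m"
    using assms by (cases k) auto
  then show ?thesis
    using legged_star_tree legged_star_Dominator_start legged_star_Staller_start by auto
qed

end
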